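(* Let $f(\zeta)=\zeta^3+a_1\zeta^2+a_2\zeta+a_3$ with $a_1,a_2,a_3\in\mathbb{C}$ be such that $\mathcal{E}=\{\eta^2=f(\zeta)\}$ is an elliptic curve (i.e. $f$ has three distinct roots). Then: (i) The doubling elements of the two-valued group $\mathbb{G}_{\mathbb{C}P^1}(B_{\boldsymbol a})$ are the point $0$ and the points of the form $1/w$, where $w$ ranges over the set of roots of $f$ (with $1/0=\infty$). (ii) The single-valued group of doubling points of $\mathbb{G}_{\mathbb{C}P^1}(B_{\boldsymbol a})$ is isomorphic to the Klein four-group $\mathbb{Z}/2\times\mathbb{Z}/2$.
   Context: $\mathbb{C}P^1=\mathbb{C}\cup\{\infty\}$, with $x=x_1/x_0$ for $(x_1:x_0)$ and $\infty=(1:0)$. For $\boldsymbol a=(a_1,a_2,a_3)$ put $$B_{\boldsymbol a}(z;x,y)=(x+y+z-a_2xyz)^2-4(1+a_3xyz)(xy+yz+xz+a_1xyz).$$ $\mathbb{G}_{\mathbb{C}P^1}(B_{\boldsymbol a})$ is $\mathbb{C}P^1$ with the two-valued multiplication $\ast:\mathbb{C}P^1\times\mathbb{C}P^1\to\mathrm{Sym}^2(\mathbb{C}P^1)$ in which $(x_1:x_0)\ast(y_1:y_0)$ is the multiset of the two zeros (with multiplicity) in $(z_1:z_0)$ of the form $(x_0y_0z_0)^2B_{\boldsymbol a}(z_1/z_0;x_1/x_0,y_1/y_0)$. When $f$ has distinct roots this is an everywhere defined associative two-valued multiplication (the $4$-multisets $[x\ast w\mid w\in y\ast z]$ and $[w\ast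 z\mid w\in x\ast y]$ coincide) with neutral element $0$ ($x\ast0=0\ast x=[x,x]$) and inverse $\mathrm{inv}(x)=x$ ($0\in x\ast x$). An element $w$ of a two-valued group is called doubling if for every element $m$ each of the multisets $w\ast m$ and $m\ast w$ is of the form $[u,u]$ ($u$ depending on $m$). The doubling elements form a set $\mathbb{W}$ closed under $\ast$ in the sense that $w_1\ast w_2=[w_3,w_3]$ with $w_3\in\mathbb{W}$; the group of doubling points is the set $\mathbb{W}$ with the single-valued operation $w_1\cdot w_2=w_3$. *)

theory Defs
  imports Complex_Main "HOL-Library.Multiset" "HOL-Algebra.Elementary_Groups"
begin

datatype cp1 = Aff complex | Inf_pt

text \<open>
  \<open>ratio x1 x0\<close> is the point with homogeneous coordinates \<open>(x1 : x0)\<close>; it is meaningful only when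
  \<open>(x1, x0)\<close> is not \<open>(0, 0)\<close>. In particular \<open>ratio 1 w\<close> is the point \<open>1 / w\<close>, with the convention
  \<open>1 / 0 = \<infinity>\<close>. The functions \<open>hc1\<close> and \<open>hc0\<close> pick the standard representative \<open>(hc1 p : hc0 p)\<close>.
\<close>

definition ratio :: "complex \<Rightarrow> complex \<Rightarrow> cp1" where
  "ratio x1 x0 = (if x0 = 0 then Inf_pt else Aff (x1 / x0))"

primrec hc1 :: "cp1 \<Rightarrow> complex" where
  "hc1 (Aff x) = x"
| "hc1 Inf_pt = 1"

primrec hc0 :: "cp1 \<Rightarrow> complex" where
  "hc0 (Aff x) = 1"
| "hc0 Inf_pt = 0"

lemma ratio_hc: "ratio (hc1 p) (hc0 p) = p"
  by (cases p) (auto simp: ratio_def)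

lemma hc_eq_iff: "hc1 p * hc0 q = hc0 p * hc1 q \<longleftrightarrow> p = q"
  by (cases p; cases q) auto


definition cubic :: "complex \<Rightarrow> complex \<Rightarrow> complex \<Rightarrow> complex \<Rightarrow> complex" where
  "cubic a1 a2 a3 \<zeta> = \<zeta>^3 + a1 * \<zeta>^2 + a2 * \<zeta> + a3"

definition B_poly :: "complex \<Rightarrow> complex \<Rightarrow> complex \<Rightarrow> complex \<Rightarrow> complex \<Rightarrow> complex \<Rightarrow> complex" where
  "B_poly a1 a2 a3 z x y =
     (x + y + z - a2 * x * y * z)^2
     - 4 * (1 + a3 * x * y * z) * (x * y + y * z + x * z + a1 * x * y * z)"

text \<open>
  The form \<open>(x0 y0 z0)\<^sup>2 B(z1/z0; x1/x0, y1/y0)\<close> with denominators cleared, so that it is also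
  defined when some of the points are infinite.
\<close>

definition B_form :: "complex \<Rightarrow> complex \<Rightarrow> complex \<Rightarrow>
    complex \<times> complex \<Rightarrow> complex \<times> complex \<Rightarrow> complex \<times> complex \<Rightarrow> complex" where
  "B_form a1 a2 a3 = (\<lambda>(z1, z0) (x1, x0) (y1, y0).
     (x1 * y0 * z0 + x0 * y1 * z0 + x0 * y0 * z1 - a2 * x1 * y1 * z1)^2
     - 4 * (x0 * y0 * z0 + a3 * x1 * y1 * z1)
         * (x1 * y1 * z0 + x0 * y1 * z1 + x1 * y0 * z1 + a1 * x1 * y1 * z1))"

lemma B_form_eq_B_poly:
  assumes "x0 \<noteq> 0" "y0 \<noteq> 0" "z0 \<noteq> 0"
  shows "B_form a1 a2 a3 (z1, z0) (x1, x0) (y1, y0) =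
           (x0 * y0 * z0)^2 * B_poly a1 a2 a3 (z1 / z0) (x1 / x0) (y1 / y0)"
proof -
  define x y z where "x = x1 / x0" and "y = y1 / y0" and "z = z1 / z0"
  have "x1 = x * x0" "y1 = y * y0" "z1 = z * z0"
    using assms by (simp_all add: x_def y_def z_def)
  moreover have "B_form a1 a2 a3 (z * z0, z0) (x * x0, x0) (y * y0, y0) =
      (x0 * y0 * z0)^2 * B_poly a1 a2 a3 z x y"
    unfolding B_form_def B_poly_def prod.case by (simp add: algebra_simps power2_eq_square power3_eq_cube power4_eq_xxxx)
  ultimately show ?thesis by (simp add: x_def y_def z_def)
qed

text \<open>
  The zeros of a binary quadratic form, with multiplicity, are read off from its factorization into
  linear forms. \<open>form_zeros q\<close> is unspecified when \<open>q\<close> is not a nonzero quadratic form.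
\<close>

definition zeros_of :: "(complex \<Rightarrow> complex \<Rightarrow> complex) \<Rightarrow> cp1 \<Rightarrow> cp1 \<Rightarrow> bool" where
  "zeros_of q u v \<longleftrightarrow> (\<exists>c. c \<noteq> 0 \<and> (\<forall>z1 z0.
     q z1 z0 = c * (hc0 u * z1 - hc1 u * z0) * (hc0 v * z1 - hc1 v * z0)))"

definition form_zeros :: "(complex \<Rightarrow> complex \<Rightarrow> complex) \<Rightarrow> cp1 multiset" where
  "form_zeros q = (THE M. \<exists>u v. M = {#u, v#} \<and> zeros_of q u v)"

definition B_mult :: "complex \<Rightarrow> complex \<Rightarrow> complex \<Rightarrow> cp1 \<Rightarrow> cp1 \<Rightarrow> cp1 multiset" where
  "B_mult a1 a2 a3 x y =
     form_zeros (\<lambda>z1 z0. B_form a1 a2 a3 (z1, z0) (hc1 x, hc0 x) (hc1 y, hc0 y))"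

definition doubling :: "('a \<Rightarrow> 'a \<Rightarrow> 'a multiset) \<Rightarrow> 'a \<Rightarrow> bool" where
  "doubling op w \<longleftrightarrow> (\<forall>m. (\<exists>u. op w m = {#u, u#}) \<and> (\<exists>u. op m w = {#u, u#}))"

definition doubling_group :: "('a \<Rightarrow> 'a \<Rightarrow> 'a multiset) \<Rightarrow> 'a \<Rightarrow> 'a monoid" where
  "doubling_group op e =
     \<lparr>carrier = {w. doubling op w},
      monoid.mult = (\<lambda>w1 w2. THE w3. op w1 w2 = {#w3, w3#}),
      one = e\<rparr>"


text \<open>
  Well-definedness: for a cubic with distinct roots the form is nonzero as a form in \<open>z\<close>, hence has
  exactly one multiset of zeros, which does not depend on the chosen homogeneous coordinates.
\<close>

lemma zeros_of_zero_iff: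
  assumes "zeros_of q u v"
  shows "q (hc1 p) (hc0 p) = 0 \<longleftrightarrow> p = u \<or> p = v"
  using assms hc_eq_iff[of p u] hc_eq_iff[of p v] unfolding zeros_of_def
  by (auto simp: mult.commute)

lemma zeros_of_unique:
  assumes "zeros_of q u v" "zeros_of q u' v'"
  shows "{#u, v#} = {#u', v'#}"
proof -
  have "p = u \<or> p = v \<longleftrightarrow> p = u' \<or> p = v'" for p
    using zeros_of_zero_iff[OF assms(1)] zeros_of_zero_iff[OF assms(2)] by metis
  then show ?thesis by (metis add_mset_commute)
qed

lemma form_zeros_eqI:
  assumes "zeros_of q u v"
  shows "form_zeros q = {#u, v#}"
  unfolding form_zeros_def using assms zeros_of_unique by (intro the_equality) blast+

lemma form_zeros_scale:
  assumes "k \<noteq> 0"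
  shows "form_zeros (\<lambda>z1 z0. k * q z1 z0) = form_zeros q"
proof -
  have "zeros_of (\<lambda>z1 z0. k * q z1 z0) u v \<longleftrightarrow> zeros_of q u v" for u v
  proof
    assume "zeros_of q u v"
    then obtain c where "c \<noteq> 0" and
      "\<And>z1 z0. q z1 z0 = c * (hc0 u * z1 - hc1 u * z0) * (hc0 v * z1 - hc1 v * z0)"
      unfolding zeros_of_def by blast
    then show "zeros_of (\<lambda>z1 z0. k * q z1 z0) u v"
      unfolding zeros_of_def using assms by (intro exI[of _ "k * c"]) (simp add: mult.assoc)
  next
    assume "zeros_of (\<lambda>z1 z0. k * q z1 z0) u v"
    then obtain c where "c \<noteq> 0" and
      "\<And>z1 z0. k * q z1 z0 = c * (hc0 u * z1 - hc1 u * z0) * (hc0 v * z1 - hc1 v * z0)"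
      unfolding zeros_of_def by blast
    then show "zeros_of q u v"
      unfolding zeros_of_def using assms by (intro exI[of _ "c / k"]) (simp add: field_simps)
  qed
  then show ?thesis by (simp add: form_zeros_def)
qed

lemma ratio_coords:
  assumes "(x1, x0) \<noteq> (0, 0)"
  obtains k where "k \<noteq> 0" "x1 = k * hc1 (ratio x1 x0)" "x0 = k * hc0 (ratio x1 x0)"
proof (cases "x0 = 0")
  case True
  with assms show ?thesis by (intro that[of x1]) (auto simp: ratio_def)
next
  case False
  then show ?thesis by (intro that[of x0]) (auto simp: ratio_def)
qed

lemma B_mult_ratio:
  assumes "(x1, x0) \<noteq> (0, 0)" "(y1, y0) \<noteq> (0, 0)"
  shows "B_mult a1 a2 a3 (ratio x1 x0) (ratio y1 y0) =
           form_zeros (\<lambda>z1 z0. B_form a1 a2 a3 (z1, z0) (x1, x0) (y1, y0))"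
proof -
  obtain k where k: "k \<noteq> 0" "x1 = k * hc1 (ratio x1 x0)" "x0 = k * hc0 (ratio x1 x0)"
    using ratio_coords[OF assms(1)] .
  obtain l where l: "l \<noteq> 0" "y1 = l * hc1 (ratio y1 y0)" "y0 = l * hc0 (ratio y1 y0)"
    using ratio_coords[OF assms(2)] .
  have scale: "B_form a1 a2 a3 (z1, z0) (k * s1, k * s0) (l * t1, l * t0) =
      (k * l)^2 * B_form a1 a2 a3 (z1, z0) (s1, s0) (t1, t0)" for z1 z0 s1 s0 t1 t0
    unfolding B_form_def prod.case by (simp add: algebra_simps power2_eq_square power3_eq_cube power4_eq_xxxx)
  have "B_form a1 a2 a3 (z1, z0) (x1, x0) (y1, y0) =
      (k * l)^2 * B_form a1 a2 a3 (z1, z0) (hc1 (ratio x1 x0), hc0 (ratio x1 x0))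
        (hc1 (ratio y1 y0), hc0 (ratio y1 y0))" for z1 z0
    using scale k(2,3) l(2,3) by metis
  moreover have "(k * l)^2 \<noteq> 0" using k l by simp
  ultimately show ?thesis by (simp add: B_mult_def form_zeros_scale)
qed

lemma quadratic_form_zeros:
  fixes A B C :: complex
  assumes "\<not> (A = 0 \<and> B = 0 \<and> C = 0)"
  shows "\<exists>u v. zeros_of (\<lambda>z1 z0. A * z1^2 + B * z1 * z0 + C * z0^2) u v"
proof (cases "A = 0")
  case True
  show ?thesis
  proof (cases "B = 0")
    case True
    with \<open>A = 0\<close> assms have "zeros_of (\<lambda>z1 z0. A * z1^2 + B * z1 * z0 + C * z0^2) Inf_pt Inf_pt"
      unfolding zeros_of_def by (intro exI[of _ C]) (simp add: power2_eq_square)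
    then show ?thesis by blast
  next
    case False
    with \<open>A = 0\<close> have "zeros_of (\<lambda>z1 z0. A * z1^2 + B * z1 * z0 + C * z0^2) Inf_pt (Aff (- C / B))"
      unfolding zeros_of_def by (intro exI[of _ "- B"]) (simp add: field_simps power2_eq_square)
    then show ?thesis by blast
  qed
next
  case False
  define s where "s = csqrt (B^2 - 4 * A * C)"
  define r t where "r = (- B + s) / (2 * A)" and "t = (- B - s) / (2 * A)"
  have s2: "s^2 = B^2 - 4 * A * C" by (simp add: s_def)
  have sum: "A * (r + t) = - B" using False by (simp add: r_def t_def field_simps)
  have "A * (r * t) = (B^2 - s^2) / (4 * A)"
    using False by (simp add: r_def t_def field_simps power2_eq_square)
  also have "\<dots> = C" using False by (simp add: s2 field_simps)
  finally have prod: "A * (r * t) = C" .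
  have BC: "B = - (A * (r + t))" "C = A * (r * t)" using sum prod by simp_all
  have "A * z1^2 + B * z1 * z0 + C * z0^2 = A * (z1 - r * z0) * (z1 - t * z0)" for z1 z0
    unfolding BC by (simp add: algebra_simps power2_eq_square)
  then have "zeros_of (\<lambda>z1 z0. A * z1^2 + B * z1 * z0 + C * z0^2) (Aff r) (Aff t)"
    unfolding zeros_of_def using False by (intro exI[of _ A]) simp
  then show ?thesis by blast
qed

lemma cubic_simple_root:
  assumes roots: "card {\<zeta>. cubic a1 a2 a3 \<zeta> = 0} = 3" and w: "cubic a1 a2 a3 w = 0"
  shows "3 * w^2 + 2 * a1 * w + a2 \<noteq> 0"
proof
  assume d: "3 * w^2 + 2 * a1 * w + a2 = 0"
  have a2: "a2 = - (3 * w^2 + 2 * a1 * w)"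
    using d by (simp add: add_eq_0_iff add.commute)
  have "a3 = - (w^3 + a1 * w^2 + a2 * w)"
    using w by (simp add: cubic_def add_eq_0_iff)
  then have a3: "a3 = 2 * w^3 + a1 * w^2"
    by (simp add: a2 algebra_simps power2_eq_square power3_eq_cube)
  note a = a2 a3
  have fact: "cubic a1 a2 a3 z = (z - w)^2 * (z + 2 * w + a1)" for z
    unfolding cubic_def a by (simp add: algebra_simps power2_eq_square power3_eq_cube)
  have "{\<zeta>. cubic a1 a2 a3 \<zeta> = 0} \<subseteq> {w, - 2 * w - a1}"
  proof (intro subsetI)
    fix z assume "z \<in> {\<zeta>. cubic a1 a2 a3 \<zeta> = 0}"
    with fact have "(z - w)^2 * (z + 2 * w + a1) = 0" by simp
    then have "z = w \<or> z + (2 * w + a1) = 0" by (simp add: add.assoc)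
    then show "z \<in> {w, - 2 * w - a1}" by (auto simp: add_eq_0_iff2)
  qed
  then have "card {\<zeta>. cubic a1 a2 a3 \<zeta> = 0} \<le> card {w, - 2 * w - a1}"
    by (intro card_mono) auto
  also have "\<dots> \<le> 2" by (simp add: card_insert_if)
  finally show False using roots by simp
qed

lemma B_form_zeros_exist:
  assumes roots: "card {\<zeta>. cubic a1 a2 a3 \<zeta> = 0} = 3"
  shows "\<exists>u v. zeros_of (\<lambda>z1 z0. B_form a1 a2 a3 (z1, z0) (hc1 x, hc0 x) (hc1 y, hc0 y)) u v"
proof -
  define x1 x0 y1 y0 where c: "x1 = hc1 x" "x0 = hc0 x" "y1 = hc1 y" "y0 = hc0 y"
  define A where "A = (x0 * y0 - a2 * x1 * y1)^2
    - 4 * a3 * x1 * y1 * (x0 * y1 + x1 * y0 + a1 * x1 * y1)"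
  define B where "B = 2 * (x1 * y0 + x0 * y1) * (x0 * y0 - a2 * x1 * y1)
    - 4 * x0 * y0 * (x0 * y1 + x1 * y0 + a1 * x1 * y1) - 4 * a3 * x1^2 * y1^2"
  define C where "C = (x1 * y0 - x0 * y1)^2"
  have form: "B_form a1 a2 a3 (z1, z0) (x1, x0) (y1, y0) = A * z1^2 + B * z1 * z0 + C * z0^2" for z1 z0
    unfolding B_form_def prod.case A_def B_def C_def by (simp add: algebra_simps power2_eq_square power3_eq_cube power4_eq_xxxx)
  have "\<not> (A = 0 \<and> B = 0 \<and> C = 0)"
  proof
    assume 0: "A = 0 \<and> B = 0 \<and> C = 0"
    then have "x = y" using hc_eq_iff[of x y] by (simp add: C_def c)
    then have xy: "y1 = x1" "y0 = x0" by (simp_all add: c)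
    show False
    proof (cases "x1 = 0")
      case True
      then show False using 0 by (cases x) (auto simp: A_def xy c)
    next
      case False
      define w where "w = x0 / x1"
      have w: "x0 = w * x1" using False by (simp add: w_def)
      have "B = - 4 * x1^4 * cubic a1 a2 a3 w"
        unfolding B_def xy w cubic_def by (simp add: algebra_simps power2_eq_square power3_eq_cube power4_eq_xxxx)
      with 0 False have root: "cubic a1 a2 a3 w = 0" by simp
      then have a3: "a3 = - (w^3 + a1 * w^2 + a2 * w)" by (simp add: cubic_def add_eq_0_iff)
      have "A = x1^4 * (3 * w^2 + 2 * a1 * w + a2)^2"
        unfolding A_def xy w a3 by (simp add: algebra_simps power2_eq_square power3_eq_cube power4_eq_xxxx)
      with 0 False cubic_simple_root[OF roots root] show False by simp
    qed
  qed
  then show ?thesis using quadratic_form_zeros[of A B C] by (simp add: form flip: c)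
qed

theorem B_mult_eq_iff:
  assumes "card {\<zeta>. cubic a1 a2 a3 \<zeta> = 0} = 3"
  shows "B_mult a1 a2 a3 x y = {#u, v#} \<longleftrightarrow>
    zeros_of (\<lambda>z1 z0. B_form a1 a2 a3 (z1, z0) (hc1 x, hc0 x) (hc1 y, hc0 y)) u v"
proof -
  let ?q = "\<lambda>z1 z0. B_form a1 a2 a3 (z1, z0) (hc1 x, hc0 x) (hc1 y, hc0 y)"
  obtain s t where st: "zeros_of ?q s t" using B_form_zeros_exist[OF assms] by blast
  have sym: "zeros_of ?q t s"
    using st unfolding zeros_of_def by (simp add: mult_ac)
  have "B_mult a1 a2 a3 x y = {#s, t#}"
    unfolding B_mult_def by (rule form_zeros_eqI[OF st])
  then show ?thesis
    using st sym form_zeros_eqI[of ?q u v] by (auto simp: B_mult_def add_eq_conv_ex add_mset_eq_single)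
qed

lemma B_mult_neutral:
  assumes "card {\<zeta>. cubic a1 a2 a3 \<zeta> = 0} = 3"
  shows "B_mult a1 a2 a3 x (Aff 0) = {#x, x#}" "B_mult a1 a2 a3 (Aff 0) x = {#x, x#}"
  unfolding B_mult_eq_iff[OF assms] zeros_of_def
  by (rule exI[of _ 1], simp add: B_form_def algebra_simps power2_eq_square)+

end

theory Submission
  imports Defs
begin

text \<open>
  As a binary quadratic form in \<open>(z\<^sub>1 : z\<^sub>0)\<close>, the form defining \<open>x \<ast> y\<close> has the discriminant
  \<open>16 F(x) F(y)\<close> (\<open>B_form_discriminant\<close>), where \<open>F(x\<^sub>1, x\<^sub>0) = x\<^sub>1\<^sup>4 f(x\<^sub>0 / x\<^sub>1)\<close>, a quartic form, vanishes
  exactly at \<open>0\<close> and at the points \<open>1 / w\<close> with \<open>f(w) = 0\<close>. The two values of \<open>x \<ast> y\<close> coincide iff the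
  discriminant vanishes. Since \<open>F\<close> is not identically zero, \<open>x \<ast> m\<close> is a double point for all \<open>m\<close> iff
  \<open>F(x) = 0\<close>, which is (i).

  For (ii), a product of doubling points is a double point, so it is known once a single zero of the
  form is known. One such zero is \<open>0\<close> in \<open>x \<ast> x\<close>. If \<open>u, v, w\<close> are the roots of \<open>f\<close>, then \<open>1 / w\<close> is a zero
  of the form for \<open>1 / u \<ast> 1 / v\<close>: by Vieta's formulas both summands of the form vanish there. Together
  with neutrality of \<open>0\<close> this gives the multiplication table of the Klein four-group.

  Geometrically, \<open>x \<mapsto> 1 / x\<close> identifies the points with the quotient of the curve by \<open>\<plusminus>1\<close>, \<open>F\<close> vanishes at
  the branch points, and the doubling points are the images of the 2-torsion points.
\<close>

text \<open>
  For \<open>q = A z\<^sub>1\<^sup>2 + B z\<^sub>1 z\<^sub>0 + C z\<^sub>0\<^sup>2\<close> the three values below are \<open>A + B + C\<close>, \<open>A\<close> and \<open>C\<close>, so that the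
  condition is \<open>B\<^sup>2 = 4 A C\<close>.
\<close>

lemma zeros_of_double_iff:
  assumes "zeros_of q u v"
  shows "u = v \<longleftrightarrow> (q 1 1 - q 1 0 - q 0 1)\<^sup>2 - 4 * q 1 0 * q 0 1 = 0"
proof -
  obtain c where c: "c \<noteq> 0"
    and q: "\<And>z1 z0. q z1 z0 = c * (hc0 u * z1 - hc1 u * z0) * (hc0 v * z1 - hc1 v * z0)"
    using assms unfolding zeros_of_def by blast
  have "(q 1 1 - q 1 0 - q 0 1)\<^sup>2 - 4 * q 1 0 * q 0 1 = (c * (hc1 u * hc0 v - hc0 u * hc1 v))\<^sup>2"
    unfolding q by (simp add: algebra_simps power2_eq_square)
  then show ?thesis using c hc_eq_iff[of u v] by simp
qed

text \<open>
  The cubic \<open>f\<close> at \<open>x\<^sub>0 / x\<^sub>1\<close>, cleared of denominators with \<open>x\<^sub>1\<^sup>4\<close> instead of \<open>x\<^sub>1\<^sup>3\<close>: the extra factor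
  accounts for the branch point of the curve at infinity, which corresponds to \<open>x = 0\<close>.
\<close>

definition homog_quartic :: "complex \<Rightarrow> complex \<Rightarrow> complex \<Rightarrow> cp1 \<Rightarrow> complex" where
  "homog_quartic a1 a2 a3 x = hc1 x *
     (hc0 x ^ 3 + a1 * hc0 x ^ 2 * hc1 x + a2 * hc0 x * hc1 x ^ 2 + a3 * hc1 x ^ 3)"

lemma homog_quartic_eq_0_iff:
  "homog_quartic a1 a2 a3 x = 0 \<longleftrightarrow> x \<in> insert (Aff 0) {ratio 1 w | w. cubic a1 a2 a3 w = 0}"
proof (cases "x = Aff 0")
  case True
  then show ?thesis by (simp add: homog_quartic_def)
next
  case False
  then have h: "hc1 x \<noteq> 0" by (cases x) auto
  define w where "w = hc0 x / hc1 x"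
  have w: "hc0 x = w * hc1 x" using h by (simp add: w_def)
  have F: "homog_quartic a1 a2 a3 x = hc1 x ^ 4 * cubic a1 a2 a3 w"
    unfolding homog_quartic_def w cubic_def
    by (simp add: algebra_simps power2_eq_square power3_eq_cube power4_eq_xxxx)
  have "x = ratio 1 w' \<longleftrightarrow> w' = w" for w'
    using h unfolding w_def ratio_def by (cases x) (auto simp: field_simps)
  then show ?thesis using F h False by auto
qed

text \<open>
  The discriminant separates \<open>x\<close> from \<open>y\<close>, so that one point alone can force the two values of the
  product to coincide. The identity is one of polynomials in \<open>a\<^sub>1, a\<^sub>2, a\<^sub>3\<close> and the coordinates.
\<close>

lemma B_form_discriminant:
  fixes a1 a2 a3 :: complex and x y :: cp1
  defines "q \<equiv> \<lambda>z1 z0. B_form a1 a2 a3 (z1, z0) (hc1 x, hc0 x) (hc1 y, hc0 y)"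
  shows "(q 1 1 - q 1 0 - q 0 1)\<^sup>2 - 4 * q 1 0 * q 0 1 =
    16 * homog_quartic a1 a2 a3 x * homog_quartic a1 a2 a3 y"
  unfolding q_def B_form_def homog_quartic_def prod.case by algebra

context
  fixes a1 a2 a3 :: complex
  assumes distinct_roots: "card {\<zeta>. cubic a1 a2 a3 \<zeta> = 0} = 3"
begin

lemma B_mult_double_iff:
  "(\<exists>u. B_mult a1 a2 a3 x y = {#u, u#}) \<longleftrightarrow>
    homog_quartic a1 a2 a3 x = 0 \<or> homog_quartic a1 a2 a3 y = 0"
proof -
  obtain u v where
    z: "zeros_of (\<lambda>z1 z0. B_form a1 a2 a3 (z1, z0) (hc1 x, hc0 x) (hc1 y, hc0 y)) u v"
    using B_form_zeros_exist[OF distinct_roots] by blast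
  have "B_mult a1 a2 a3 x y = {#u, v#}"
    using z by (simp add: B_mult_eq_iff[OF distinct_roots])
  then have "(\<exists>t. B_mult a1 a2 a3 x y = {#t, t#}) \<longleftrightarrow> u = v"
    by (auto simp: add_mset_eq_single add_eq_conv_ex)
  then show ?thesis
    unfolding zeros_of_double_iff[OF z] B_form_discriminant by simp
qed

lemma doubling_iff: "doubling (B_mult a1 a2 a3) x \<longleftrightarrow> homog_quartic a1 a2 a3 x = 0"
proof -
  have fin: "finite {\<zeta>. cubic a1 a2 a3 \<zeta> = 0}"
    using distinct_roots by (metis card.infinite zero_neq_numeral)
  obtain \<zeta> where "cubic a1 a2 a3 \<zeta> \<noteq> 0"
    using ex_new_if_finite[OF infinite_UNIV_char_0 fin] by auto
  then have "homog_quartic a1 a2 a3 (ratio 1 \<zeta>) \<noteq> 0"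
    unfolding homog_quartic_eq_0_iff by (auto simp: ratio_def split: if_splits)
  then show ?thesis
    unfolding doubling_def B_mult_double_iff by blast
qed

text \<open>A product with a doubling point is determined by any one of its values.\<close>

lemma B_mult_doubling_eqI:
  assumes "homog_quartic a1 a2 a3 x = 0"
    and "B_form a1 a2 a3 (hc1 p, hc0 p) (hc1 x, hc0 x) (hc1 y, hc0 y) = 0"
  shows "B_mult a1 a2 a3 x y = {#p, p#}"
proof -
  obtain u where u: "B_mult a1 a2 a3 x y = {#u, u#}"
    using assms(1) B_mult_double_iff by blast
  then have "p = u"
    using assms(2) zeros_of_zero_iff[of _ u u p]
    unfolding B_mult_eq_iff[OF distinct_roots] by blast
  with u show ?thesis by simp
qed

lemma B_mult_self:
  assumes "homog_quartic a1 a2 a3 x = 0"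
  shows "B_mult a1 a2 a3 x x = {#Aff 0, Aff 0#}"
  by (rule B_mult_doubling_eqI[OF assms]) (simp add: B_form_def algebra_simps power2_eq_square)

lemma Vieta_cubic:
  assumes "cubic a1 a2 a3 u = 0" "cubic a1 a2 a3 v = 0" "cubic a1 a2 a3 w = 0"
    and "u \<noteq> v" "u \<noteq> w" "v \<noteq> w"
  shows "a1 = - (u + v + w)" "a2 = u * v + v * w + u * w" "a3 = - (u * v * w)"
proof -
  \<comment> \<open>The divided differences of \<open>f\<close> at \<open>u, v\<close>, at \<open>u, w\<close> and at \<open>u, v, w\<close> vanish.\<close>
  have "(u - v) * (u^2 + u * v + v^2 + a1 * (u + v) + a2) = 0"
    using assms(1,2) unfolding cubic_def by algebra
  then have uv: "u^2 + u * v + v^2 + a1 * (u + v) + a2 = 0" using assms by simp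
  have "(u - w) * (u^2 + u * w + w^2 + a1 * (u + w) + a2) = 0"
    using assms(1,3) unfolding cubic_def by algebra
  then have uw: "u^2 + u * w + w^2 + a1 * (u + w) + a2 = 0" using assms by simp
  have "(v - w) * (u + v + w + a1) = 0" using uv uw by algebra
  then show 1: "a1 = - (u + v + w)" using assms(6) by (simp add: add_eq_0_iff)
  show 2: "a2 = u * v + v * w + u * w" using uv unfolding 1 by algebra
  show "a3 = - (u * v * w)" using assms(1) unfolding cubic_def 1 2 by algebra
qed

lemma B_mult_roots:
  assumes "cubic a1 a2 a3 u = 0" "cubic a1 a2 a3 v = 0" "cubic a1 a2 a3 w = 0"
    and "u \<noteq> v" "u \<noteq> w" "v \<noteq> w"
  shows "B_mult a1 a2 a3 (ratio 1 u) (ratio 1 v) = {#ratio 1 w, ratio 1 w#}"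
proof (rule B_mult_doubling_eqI)
  show "homog_quartic a1 a2 a3 (ratio 1 u) = 0"
    unfolding homog_quartic_eq_0_iff using assms(1) by blast
  have h: "hc0 (ratio 1 t) = t * hc1 (ratio 1 t)" for t
    by (simp add: ratio_def)
  show "B_form a1 a2 a3 (hc1 (ratio 1 w), hc0 (ratio 1 w))
      (hc1 (ratio 1 u), hc0 (ratio 1 u)) (hc1 (ratio 1 v), hc0 (ratio 1 v)) = 0"
    unfolding B_form_def prod.case h Vieta_cubic[OF assms] by (simp add: algebra_simps)
qed

end

text \<open>
  Only the table of products is assumed: the group laws of \<open>G\<close> are carried over from
  \<open>\<int>/2 \<times> \<int>/2\<close> along the bijection.
\<close>

lemma Klein_four_iso:
  fixes G (structure)
  assumes carrier: "carrier G = {\<one>, a, b, c}"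
    and distinct: "distinct [\<one>, a, b, c]"
    and one: "\<And>x. x \<in> carrier G \<Longrightarrow> \<one> \<otimes> x = x" "\<And>x. x \<in> carrier G \<Longrightarrow> x \<otimes> \<one> = x"
    and square: "\<And>x. x \<in> carrier G \<Longrightarrow> x \<otimes> x = \<one>"
    and table: "a \<otimes> b = c" "b \<otimes> a = c" "a \<otimes> c = b" "c \<otimes> a = b" "b \<otimes> c = a" "c \<otimes> b = a"
  shows "group G \<and> G \<cong> integer_mod_group 2 \<times>\<times> integer_mod_group 2"
proof -
  let ?K = "integer_mod_group 2 \<times>\<times> integer_mod_group 2"
  define h :: "int \<times> int \<Rightarrow> 'a" where
    "h = (\<lambda>(i, j). if i = 0 then if j = 0 then \<one> else b else if j = 0 then a else c)"
  have two: "{0..<2} = {0, 1::int}" by auto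
  have K: "carrier ?K = {(0, 0), (1, 0), (0, 1), (1, 1)}"
    by (auto simp: carrier_integer_mod_group two)
  interpret K: group ?K by (simp add: DirProd_group)
  have "h \<in> hom ?K G"
    unfolding hom_def K carrier using one square table
    by (auto simp: h_def carrier mult_integer_mod_group)
  moreover have "bij_betw h (carrier ?K) (carrier G)"
    unfolding bij_betw_def K carrier using distinct by (auto simp: h_def)
  ultimately have iso: "h \<in> iso ?K G" by (simp add: iso_def)
  have "h \<one>\<^bsub>?K\<^esub> = \<one>" by (simp add: h_def)
  then have "group G" using K.iso_imp_img_group[OF iso] by simp
  then show ?thesis using iso K.iso_sym unfolding is_iso_def by blast
qed

theorem theorem2:
  fixes a1 a2 a3 :: complex
  assumes "card {\<zeta>. cubic a1 a2 a3 \<zeta> = 0} = 3"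
  shows "{w. doubling (B_mult a1 a2 a3) w} =
           insert (Aff 0) {ratio 1 w | w. cubic a1 a2 a3 w = 0}
       \<and> group (doubling_group (B_mult a1 a2 a3) (Aff 0))
       \<and> doubling_group (B_mult a1 a2 a3) (Aff 0) \<cong> integer_mod_group 2 \<times>\<times> integer_mod_group 2"
proof -
  let ?G = "doubling_group (B_mult a1 a2 a3) (Aff 0)"
  have W: "{w. doubling (B_mult a1 a2 a3) w} =
      insert (Aff 0) {ratio 1 w | w. cubic a1 a2 a3 w = 0}"
    using doubling_iff[OF assms] homog_quartic_eq_0_iff by blast
  obtain u v w where roots: "{\<zeta>. cubic a1 a2 a3 \<zeta> = 0} = {u, v, w}"
    and ne: "u \<noteq> v" "u \<noteq> w" "v \<noteq> w"
    using assms unfolding card_3_iff by blast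
  have root: "cubic a1 a2 a3 u = 0" "cubic a1 a2 a3 v = 0" "cubic a1 a2 a3 w = 0"
    using roots by blast+
  have mult: "x \<otimes>\<^bsub>?G\<^esub> y = p" if "B_mult a1 a2 a3 x y = {#p, p#}" for x y p
  proof -
    have "t = p" if "{#p, p#} = {#t, t#}" for t
      using arg_cong[OF that, of set_mset] by simp
    then have "(THE t. {#p, p#} = {#t, t#}) = p" by (intro the_equality) auto
    then show ?thesis using that by (simp add: doubling_group_def)
  qed
  have one: "\<one>\<^bsub>?G\<^esub> = Aff 0" by (simp add: doubling_group_def)
  have "{ratio 1 w | w. cubic a1 a2 a3 w = 0} = ratio 1 ` {u, v, w}"
    unfolding roots[symmetric] by blast
  then have carrier: "carrier ?G = {\<one>\<^bsub>?G\<^esub>, ratio 1 u, ratio 1 v, ratio 1 w}"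
    unfolding one by (simp add: doubling_group_def W)
  have "group ?G \<and> ?G \<cong> integer_mod_group 2 \<times>\<times> integer_mod_group 2"
  proof (rule Klein_four_iso[OF carrier])
    show "distinct [\<one>\<^bsub>?G\<^esub>, ratio 1 u, ratio 1 v, ratio 1 w]"
      unfolding one using ne by (auto simp: ratio_def)
    show "\<one>\<^bsub>?G\<^esub> \<otimes>\<^bsub>?G\<^esub> x = x" "x \<otimes>\<^bsub>?G\<^esub> \<one>\<^bsub>?G\<^esub> = x" for x
      unfolding one by (intro mult B_mult_neutral[OF assms])+
    show "x \<otimes>\<^bsub>?G\<^esub> x = \<one>\<^bsub>?G\<^esub>" if "x \<in> carrier ?G" for x
      unfolding one using that doubling_iff[OF assms]
      by (intro mult B_mult_self[OF assms]) (simp add: doubling_group_def)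
  qed (intro mult B_mult_roots[OF assms] root ne ne[symmetric])+
  with W show ?thesis by blast
qed

end
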